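(* Let $V$ be a quasi-vertex operator algebra, $\Gamma\subset\mathrm{PSL}_2(\mathbb R)$ a Fuchsian group of the first kind, and $\gamma_i\in\Gamma$ a generator of the order-$m_i$ stabilizer of an elliptic point $\tau_i$. Fix a weight $k$ and $N$, and set $\lambda_n:=j(\gamma_i,\tau_i)^{k-2n}$ for $0\le n\le N$, the eigenvalue by which $j(\gamma_i,\tau_i)^kK(\gamma_i,\tau_i)$ acts on the associated graded piece $F_nV/F_{n-1}V\cong V_n$. Suppose $\lambda_{n_0}=1$ for a unique $n_0\in\{0,\dots,N\}$ with $V_{n_0}\ne0$, and $\lambda_n\ne1$ for every other such $n$. Then the fixed subspace $$\{v\in F_NV:\ j(\gamma_i,\tau_i)^kK(\gamma_i,\tau_i)v=v\}$$ has dimension $\dim V_{n_0}$, and projection onto the $V_{n_0}$-component is an isomorphism from this fixed subspace onto $V_{n_0}$: every $v_0\in V_{n_0}$ extends uniquely to a fixed vector $v_0+v_0'$ with $v_0'\in F_{n_0-1}V$, with no further constraint on $v_0$. If no $n\le N$ with $V_n\ne0$ has $\lambda_n=1$, the fixed subspace is $0$.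
   Context: QVOA: a quasi-vertex operator algebra is a $\mathbb Z$-graded vertex algebra $V=\bigoplus_n V_n$ over $\mathbb C$ (vertex operators $Y$, vacuum $\mathbf 1$) with $\dim V_n<\infty$ and $V_n=0$ for $n\ll0$, together with operators $L(-1),L(0),L(1)$ satisfying $[L(m),L(n)]=(m-n)L(m+n)$, where $L(-1)$ is the canonical derivation, $L(0)$ acts on $V_n$ as $n$ and $[L(1),Y(u,z)]=Y((L(1)+2zL(0)+z^2L(-1))u,z)$. $F_NV=\bigoplus_{n\le N}V_n$. Elements of $\Gamma$ are lifted to $\mathrm{SL}_2(\mathbb R)$. For $\gamma=\begin{pmatrix}a&b\\c&d\end{pmatrix}$: $j(\gamma,\tau)=c\tau+d$ and $K(\gamma,\tau)=e^{-c\,j(\gamma,\tau)L(1)}j(\gamma,\tau)^{-2L(0)}\in\mathrm{End}(V)$, which preserves every $F_NV$. The weight $k$ is an integer.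
   Formalization: The condition λ_n ≠ 1 for every other n with V_n ≠ 0 is required for all integers n ≤ N, negative ones included, not just 0 ≤ n ≤ N (a negative degree with λ_n = 1 would enlarge the fixed subspace); n_0 and N may be any integers with n_0 ≤ N. *)

theory Defs
  imports
    "HOL-Analysis.Analysis"
    "HOL-Algebra.Generated_Groups"
    "HOL-Library.Groups_Big_Fun"
begin

section \<open>Quasi-vertex operator algebras\<close>

text \<open>All infinite sums below have only finitely many nonzero terms; they are written with
  \<^const>\<open>Sum_any\<close>, which sums over the support of its argument.\<close>

locale graded_space = vector_space scale
  for scale :: "complex \<Rightarrow> 'v::ab_group_add \<Rightarrow> 'v" +
  fixes V :: "int \<Rightarrow> 'v set"
  assumes subspace_component: "subspace (V n)"
    and direct_sum: "\<exists>!f. (\<forall>n. f n \<in> V n) \<and> finite {n. f n \<noteq> 0} \<and> v = Sum_any f"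
begin

definition component :: "int \<Rightarrow> 'v \<Rightarrow> 'v" where
  "component n v = (THE f. (\<forall>n. f n \<in> V n) \<and> finite {n. f n \<noteq> 0} \<and> v = Sum_any f) n"

definition filtration :: "int \<Rightarrow> 'v set" where
  "filtration N = span (\<Union>n\<in>{..N}. V n)"

end

text \<open>The term \<open>Y u n v\<close> is the mode \<open>u\<^sub>(\<^sub>n\<^sub>) v\<close>, where \<open>Y(u,z) = \<Sum>\<^sub>n u\<^sub>(\<^sub>n\<^sub>) z\<^bsup>-n-1\<^esup>\<close>. The axiom
  \<open>borcherds\<close> is the Jacobi identity read off coefficientwise.\<close>

locale graded_vertex_algebra = graded_space scale V
  for scale :: "complex \<Rightarrow> 'v::ab_group_add \<Rightarrow> 'v" and V :: "int \<Rightarrow> 'v set" +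
  fixes Y :: "'v \<Rightarrow> int \<Rightarrow> 'v \<Rightarrow> 'v" and vac :: 'v
  assumes linear_right: "Vector_Spaces.linear scale scale (Y u n)"
    and linear_left: "Vector_Spaces.linear scale scale (\<lambda>u. Y u n v)"
    and truncation: "\<exists>n0. \<forall>n\<ge>n0. Y u n v = 0"
    and vacuum: "Y vac n v = (if n = -1 then v else 0)"
    and creation: "Y u (-1) vac = u" "n \<ge> 0 \<Longrightarrow> Y u n vac = 0"
    and borcherds:
      "Sum_any (\<lambda>i. scale (of_int m gchoose i) (Y (Y u (n + int i) v) (m + l - int i) w)) =
       Sum_any (\<lambda>i. scale ((-1) ^ i * (of_int n gchoose i))
         (Y u (m + n - int i) (Y v (l + int i) w)
          - scale ((-1) powi n) (Y v (n + l - int i) (Y u (m + int i) w))))"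
    and vacuum_degree: "vac \<in> V 0"
    and mode_degree: "u \<in> V p \<Longrightarrow> v \<in> V q \<Longrightarrow> Y u n v \<in> V (p + q - n - 1)"

text \<open>Only \<open>L (-1)\<close>, \<open>L 0\<close> and \<open>L 1\<close> are constrained or used. In \<open>sl2_relations\<close> the sum
  \<open>i + j\<close> leaves the range \<open>{-1, 0, 1}\<close> only if \<open>i = j\<close>, where the coefficient vanishes.
  The axiom \<open>L1_commutator\<close> is the coefficient of \<open>z\<^bsup>-n-1\<^esup>\<close> in
  \<open>[L(1), Y(u,z)] = Y((L(1) + 2zL(0) + z\<^sup>2L(-1))u, z)\<close>.\<close>

locale quasi_voa = graded_vertex_algebra scale V Y vac
  for scale :: "complex \<Rightarrow> 'v::ab_group_add \<Rightarrow> 'v" and V :: "int \<Rightarrow> 'v set"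
    and Y :: "'v \<Rightarrow> int \<Rightarrow> 'v \<Rightarrow> 'v" and vac :: 'v +
  fixes L :: "int \<Rightarrow> 'v \<Rightarrow> 'v"
  assumes finite_dim: "\<exists>B. finite B \<and> V n = span B"
    and bounded_below: "\<exists>n0. \<forall>n<n0. V n = {0}"
    and linear_L: "i \<in> {-1, 0, 1} \<Longrightarrow> Vector_Spaces.linear scale scale (L i)"
    and sl2_relations: "i \<in> {-1, 0, 1} \<Longrightarrow> j \<in> {-1, 0, 1} \<Longrightarrow>
      L i (L j v) - L j (L i v) = scale (of_int (i - j)) (L (i + j) v)"
    and L_minus1: "L (-1) v = Y v (-2) vac"
    and L0_eigen: "v \<in> V n \<Longrightarrow> L 0 v = scale (of_int n) v"
    and L1_commutator: "L 1 (Y u n v) - Y u n (L 1 v) =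
      Y (L 1 u) n v + scale 2 (Y (L 0 u) (n + 1) v) + Y (L (-1) u) (n + 2) v"

section \<open>The action of \<open>SL\<^sub>2(\<real>)\<close> on the upper half plane\<close>

definition moebius :: "real^2^2 \<Rightarrow> complex \<Rightarrow> complex" where
  "moebius g z = (of_real (g$1$1) * z + of_real (g$1$2)) / (of_real (g$2$1) * z + of_real (g$2$2))"

definition aut_factor :: "real^2^2 \<Rightarrow> complex \<Rightarrow> complex" where
  "aut_factor g z = of_real (g$2$1) * z + of_real (g$2$2)"

definition upper_half_plane :: "complex set" where
  "upper_half_plane = {z. Im z > 0}"

section \<open>The operator \<open>K\<close>\<close>

context quasi_voa
begin

definition exp_op :: "('v \<Rightarrow> 'v) \<Rightarrow> 'v \<Rightarrow> 'v" where
  "exp_op A v = Sum_any (\<lambda>i. scale (1 / fact i) ((A ^^ i) v))"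

text \<open>\<open>x\<^bsup>-2L(0)\<^esup>\<close>, which multiplies \<open>V n\<close> by \<open>x\<^bsup>-2n\<^esup>\<close>.\<close>

definition power_L0 :: "complex \<Rightarrow> 'v \<Rightarrow> 'v" where
  "power_L0 x v = Sum_any (\<lambda>n. scale (x powi (- 2 * n)) (component n v))"

definition K :: "real^2^2 \<Rightarrow> complex \<Rightarrow> 'v \<Rightarrow> 'v" where
  "K g \<tau> v = exp_op (\<lambda>w. scale (- of_real (g$2$1) * aut_factor g \<tau>) (L 1 w))
     (power_L0 (aut_factor g \<tau>) v)"

definition weighted_K :: "int \<Rightarrow> real^2^2 \<Rightarrow> complex \<Rightarrow> 'v \<Rightarrow> 'v" where
  "weighted_K k g \<tau> v = scale (aut_factor g \<tau> powi k) (K g \<tau> v)"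

definition fixed_subspace :: "int \<Rightarrow> int \<Rightarrow> real^2^2 \<Rightarrow> complex \<Rightarrow> 'v set" where
  "fixed_subspace k N g \<tau> = {v \<in> filtration N. weighted_K k g \<tau> v = v}"

end

section \<open>Fuchsian groups of the first kind\<close>

definition SL2R :: "(real^2^2) monoid" where
  "SL2R = \<lparr>carrier = {A. det A = 1}, mult = (**), one = mat 1\<rparr>"

text \<open>An element of \<open>PSL2R\<close> is a coset \<open>{A, -A}\<close>, that is, the set of its lifts to
  \<open>SL\<^sub>2(\<real>)\<close>.\<close>

definition PSL2R :: "(real^2^2) set monoid" where
  "PSL2R = SL2R Mod {mat 1, - mat 1}"

lemma group_SL2R: "group SL2R"
proof (rule groupI)
  fix A assume A: "A \<in> carrier SL2R"
  then have "invertible A"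
    by (simp add: SL2R_def invertible_det_nz)
  then obtain B where B: "A ** B = mat 1" "B ** A = mat 1"
    by (auto simp: invertible_def)
  have "det B = 1"
    using A arg_cong[OF B(1), of det] by (simp add: SL2R_def det_mul)
  with B show "\<exists>B\<in>carrier SL2R. B \<otimes>\<^bsub>SL2R\<^esub> A = \<one>\<^bsub>SL2R\<^esub>"
    by (auto simp: SL2R_def)
qed (auto simp: SL2R_def det_mul matrix_mul_assoc)

lemma uminus_mult_left: "(- mat 1 :: real^2^2) ** A = - A"
  by (simp add: matrix_matrix_mult_def mat_def vec_eq_iff sum_2 forall_2)

lemma uminus_mult_right: "A ** (- mat 1 :: real^2^2) = - A"
  by (simp add: matrix_matrix_mult_def mat_def vec_eq_iff sum_2 forall_2)

lemma normal_PSL2R: "{mat 1, - mat 1} \<lhd> SL2R"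
proof -
  interpret group SL2R by (rule group_SL2R)
  have inv: "inv\<^bsub>SL2R\<^esub> (- mat 1) = - mat 1"
    by (rule inv_equality) (simp_all add: SL2R_def uminus_mult_left det_2, simp_all add: mat_def)
  have "subgroup {mat 1, - mat 1} SL2R"
  proof (rule subgroupI)
    fix A assume "A \<in> {mat 1, - mat 1 :: real^2^2}"
    then show "inv\<^bsub>SL2R\<^esub> A \<in> {mat 1, - mat 1}"
      using inv inv_one by (auto simp: SL2R_def)
  qed (auto simp: SL2R_def uminus_mult_left det_2, simp_all add: mat_def)
  then show ?thesis
    by (rule normalI)
      (auto simp: r_coset_def l_coset_def SL2R_def uminus_mult_left uminus_mult_right)
qed

lemma group_PSL2R: "group PSL2R"
  unfolding PSL2R_def by (rule normal.factorgroup_is_group[OF normal_PSL2R])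

text \<open>The quotient topology.\<close>

definition PSL2R_open :: "(real^2^2) set set \<Rightarrow> bool" where
  "PSL2R_open U \<longleftrightarrow> U \<subseteq> carrier PSL2R \<and> openin (top_of_set (carrier SL2R)) (\<Union>U)"

definition PSL2R_topology :: "(real^2^2) set topology" where
  "PSL2R_topology = topology PSL2R_open"

lemma openin_PSL2R_topology: "openin PSL2R_topology = PSL2R_open"
proof -
  interpret normal "{mat 1, - mat 1}" SL2R by (rule normal_PSL2R)
  have disj: "C = D" if "C \<in> carrier PSL2R" "D \<in> carrier PSL2R" "A \<in> C" "A \<in> D" for A C D
    using rcos_disjoint[OF subgroup_axioms] that
    unfolding PSL2R_def FactGroup_def pairwise_def disjnt_def by (simp, blast)
  have Int: "\<Union>(S \<inter> T) = \<Union>S \<inter> \<Union>T" if "S \<subseteq> carrier PSL2R" "T \<subseteq> carrier PSL2R" for S T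
    using disj that by blast
  have "istopology PSL2R_open"
    unfolding istopology_def
  proof (intro conjI allI impI)
    fix S T assume "PSL2R_open S" "PSL2R_open T"
    then show "PSL2R_open (S \<inter> T)"
      unfolding PSL2R_open_def using Int[of S T] by (simp add: openin_Int le_infI1)
  next
    fix \<K> assume \<K>: "\<forall>S\<in>\<K>. PSL2R_open S"
    then have "openin (top_of_set (carrier SL2R)) (\<Union>(Union ` \<K>))"
      unfolding PSL2R_open_def by blast
    moreover have "\<Union>(Union ` \<K>) = \<Union>(\<Union>\<K>)"
      by blast
    ultimately show "PSL2R_open (\<Union>\<K>)"
      using \<K> unfolding PSL2R_open_def by (simp only: Sup_le_iff) blast
  qed
  then show ?thesis
    by (simp add: PSL2R_topology_def topology_inverse')
qed

text \<open>A real number \<open>x\<close> is a limit point of \<open>\<Gamma>\<close> if it is an accumulation point of an orbit,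
  and \<open>\<infinity>\<close> is one if an orbit is unbounded. The group is of the first kind if its limit set is all of
  \<open>\<real> \<union> {\<infinity>}\<close>; this includes all discrete groups of finite covolume.\<close>

definition orbit :: "(real^2^2) set set \<Rightarrow> complex \<Rightarrow> complex set" where
  "orbit \<Gamma> z = {moebius g z | g. g \<in> \<Union>\<Gamma>}"

definition fuchsian_first_kind :: "(real^2^2) set set \<Rightarrow> bool" where
  "fuchsian_first_kind \<Gamma> \<longleftrightarrow>
     subgroup \<Gamma> PSL2R \<and>
     subtopology PSL2R_topology \<Gamma> = discrete_topology \<Gamma> \<and>
     (\<forall>x::real. \<exists>z\<in>upper_half_plane. of_real x islimpt orbit \<Gamma> z) \<and>
     (\<exists>z\<in>upper_half_plane. \<not> bounded (orbit \<Gamma> z))"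

definition stabilizer :: "(real^2^2) set set \<Rightarrow> complex \<Rightarrow> (real^2^2) set set" where
  "stabilizer \<Gamma> \<tau> = {\<gamma>\<in>\<Gamma>. \<forall>g\<in>\<gamma>. moebius g \<tau> = \<tau>}"

definition elliptic_point :: "(real^2^2) set set \<Rightarrow> complex \<Rightarrow> bool" where
  "elliptic_point \<Gamma> \<tau> \<longleftrightarrow>
     \<tau> \<in> upper_half_plane \<and> (\<exists>\<gamma>\<in>stabilizer \<Gamma> \<tau>. \<forall>g\<in>\<gamma>. \<bar>trace g\<bar> < 2)"

end

theory Submission
  imports Defs
begin

text \<open>Because \<open>L(1)\<close> lowers the degree by one, \<open>exp (-c j L(1))\<close> differs from the identity by an
  operator that strictly lowers the filtration, and \<open>j\<^sup>k j\<^bsup>-2L(0)\<^esup>\<close> acts on \<open>V n\<close> as the scalar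
  \<open>j\<^bsup>k-2n\<^esup>\<close>. Hence \<open>j\<^sup>k K\<close> is triangular for the grading, with these scalars on the diagonal. The
  rest is linear algebra of a triangular operator \<open>T\<close> on a space graded in degrees bounded below.

  Only degrees with nonzero component matter for the diagonal entries below. If no diagonal entry
  of \<open>T\<close> in degrees \<open>\<le> M\<close> equals \<open>1\<close>, then \<open>T - 1\<close> is bijective on the
  filtration step \<open>F M\<close>: the leading term of a fixed vector has to vanish, and the equation
  \<open>(T - 1) u = w\<close> can be solved degree by degree from the top (lemmas \<open>fixed_eq_0\<close> and
  \<open>T_minus_id_solvable\<close>). If \<open>n0\<close> is the only degree \<open>\<le> N\<close> with diagonal entry \<open>1\<close>, a fixed vector
  in \<open>F N\<close> cannot have a leading term above degree \<open>n0\<close>, so it is \<open>v0 + v0'\<close> with \<open>v0 \<in> V n0\<close> and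
  \<open>v0' \<in> F (n0 - 1)\<close>. It is fixed if and only if \<open>(T - 1) v0' = - (T - 1) v0\<close>, whose right hand
  side lies in \<open>F (n0 - 1)\<close>, where \<open>T - 1\<close> is bijective. Therefore \<open>v0\<close> is arbitrary and
  determines \<open>v0'\<close>.

  Since \<open>\<tau>\<close> lies in the upper half plane, \<open>j\<close> is nonzero, so that \<open>j\<^sup>k j\<^bsup>-2n\<^esup> = j\<^bsup>k-2n\<^esup>\<close>.\<close>

section \<open>Finitely supported sums and the components of a vector\<close>

context vector_space
begin

lemma linear_Sum_any:
  assumes f: "Vector_Spaces.linear scale scale f" and fin: "finite {i. h i \<noteq> 0}"
  shows "f (Sum_any h) = Sum_any (\<lambda>i. f (h i))"
proof -
  interpret f: Vector_Spaces.linear scale scale f by (rule f)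
  have "Sum_any (\<lambda>i. f (h i)) = (\<Sum>i\<in>{i. h i \<noteq> 0}. f (h i))"
    using fin by (intro Sum_any.expand_superset) (auto simp: f.zero)
  then show ?thesis
    by (simp add: Sum_any.expand_set f.sum)
qed

text \<open>An injective linear map sends bases to bases.\<close>

lemma dim_linear_inj_image:
  assumes f: "Vector_Spaces.linear scale scale f" and S: "subspace S" and inj: "inj_on f S"
  shows "dim (f ` S) = dim S"
proof -
  interpret f: Vector_Spaces.linear scale scale f by (rule f)
  obtain B where B: "B \<subseteq> S" "independent B" "S \<subseteq> span B" "card B = dim S"
    using basis_exists by blast
  then have span: "span B = S"
    using S span_minimal by blast
  have "independent (f ` B)"
    using f.dependent_inj_imageD[of B] B(2) inj span by blast
  moreover have "span (f ` B) = f ` S"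
    by (simp add: f.span_image span)
  ultimately have "dim (f ` S) = card (f ` B)"
    by (metis dim_span_eq_card_independent)
  also have "\<dots> = dim S"
    using B inj_on_subset[OF inj] by (simp add: card_image)
  finally show ?thesis .
qed

lemma Sum_any_mem_subspace:
  assumes "subspace S" and "\<And>i. h i \<in> S"
  shows "Sum_any h \<in> S"
  using assms by (simp add: Sum_any.expand_set subspace_sum)

end

context graded_space
begin

lemma components:
  "(\<forall>n. component n v \<in> V n) \<and> finite {n. component n v \<noteq> 0}
    \<and> v = Sum_any (\<lambda>n. component n v)"
proof -
  define f where "f = (THE f. (\<forall>n. f n \<in> V n) \<and> finite {n. f n \<noteq> 0} \<and> v = Sum_any f)"
  have "(\<forall>n. f n \<in> V n) \<and> finite {n. f n \<noteq> 0} \<and> v = Sum_any f"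
    unfolding f_def by (rule theI'[OF direct_sum])
  moreover have "f = (\<lambda>n. component n v)"
    by (simp add: fun_eq_iff component_def f_def)
  ultimately show ?thesis by simp
qed

lemma component_mem: "component n v \<in> V n"
  and finite_components: "finite {n. component n v \<noteq> 0}"
  and Sum_any_components: "Sum_any (\<lambda>n. component n v) = v"
  using components[of v] by simp_all

lemma zero_mem: "0 \<in> V n"
  by (rule subspace_0[OF subspace_component])

lemma component_Sum_any:
  assumes "\<And>n. f n \<in> V n" and "finite {n. f n \<noteq> 0}"
  shows "component n (Sum_any f) = f n"
proof -
  have "(\<lambda>n. component n (Sum_any f)) = f"
    by (rule ex1E[OF direct_sum[of "Sum_any f"]]) (metis assms components)
  then show ?thesis by metis
qed

lemma component_homogeneous:
  assumes "v \<in> V n"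
  shows "component m v = (if m = n then v else 0)"
proof -
  have "Sum_any (\<lambda>m. if m = n then v else 0) = (\<Sum>m\<in>{n}. if m = n then v else 0)"
    by (rule Sum_any.expand_superset) auto
  moreover have "finite {m. (if m = n then v else 0) \<noteq> 0}"
    by (rule finite_subset[of _ "{n}"]) auto
  ultimately show ?thesis
    using component_Sum_any[of "\<lambda>m. if m = n then v else 0" m] assms by (simp add: zero_mem)
qed

lemma linear_component: "Vector_Spaces.linear scale scale (component n)"
proof (unfold_locales)
  fix u v
  have fin: "finite {m. component m u + component m v \<noteq> 0}"
    by (rule finite_subset[OF _ finite_UnI[OF finite_components[of u] finite_components[of v]]]) auto
  have "Sum_any (\<lambda>m. component m u + component m v) = u + v"
    by (simp add: Sum_any.distrib finite_components Sum_any_components)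
  with component_Sum_any[of "\<lambda>m. component m u + component m v" n]
  show "component n (u + v) = component n u + component n v"
    using fin by (simp add: component_mem subspace_add[OF subspace_component])
next
  fix c v
  have fin: "finite {m. scale c (component m v) \<noteq> 0}"
    by (rule finite_subset[OF _ finite_components[of v]]) auto
  have "scale c v = scale c (Sum_any (\<lambda>m. component m v))"
    by (simp add: Sum_any_components)
  also have "\<dots> = Sum_any (\<lambda>m. scale c (component m v))"
    by (rule linear_Sum_any[OF linear_scale_self finite_components])
  finally show "component n (scale c v) = scale c (component n v)"
    using component_Sum_any[of "\<lambda>m. scale c (component m v)" n] fin
    by (simp add: component_mem subspace_scale[OF subspace_component])
qed

lemma component_add: "component n (u + v) = component n u + component n v"
  and component_diff: "component n (u - v) = component n u - component n v"
  and component_scale: "component n (scale c v) = scale c (component n v)"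
  and component_zero: "component n 0 = 0"
proof -
  interpret Vector_Spaces.linear scale scale "component n" by (rule linear_component)
  show "component n (u + v) = component n u + component n v"
    "component n (u - v) = component n u - component n v"
    "component n (scale c v) = scale c (component n v)" "component n 0 = 0"
    by (rule add diff scale zero)+
qed

section \<open>The filtration by degree\<close>

lemma subspace_filtration: "subspace (filtration N)"
  unfolding filtration_def by (rule subspace_span)

lemma homogeneous_mem_filtration: "v \<in> V n \<Longrightarrow> n \<le> N \<Longrightarrow> v \<in> filtration N"
  unfolding filtration_def by (rule span_base) auto

lemma filtration_mono: "M \<le> N \<Longrightarrow> filtration M \<subseteq> filtration N"
  unfolding filtration_def by (rule span_mono) force

lemma filtration_iff_components: "v \<in> filtration N \<longleftrightarrow> (\<forall>n>N. component n v = 0)"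
proof
  assume "v \<in> filtration N"
  then show "\<forall>n>N. component n v = 0"
    unfolding filtration_def
    by (induction rule: span_induct_alt)
      (auto simp: component_zero component_add component_scale component_homogeneous)
next
  assume *: "\<forall>n>N. component n v = 0"
  have "component n v \<in> filtration N" for n
    using * homogeneous_mem_filtration[OF component_mem] subspace_0[OF subspace_filtration]
    by (cases "n \<le> N") auto
  then have "Sum_any (\<lambda>n. component n v) \<in> filtration N"
    by (rule Sum_any_mem_subspace[OF subspace_filtration])
  then show "v \<in> filtration N"
    by (simp add: Sum_any_components)
qed

lemma minus_leading_component:
  assumes "v \<in> filtration N"
  shows "v - component N v \<in> filtration (N - 1)"
  using assms unfolding filtration_iff_components
  by (auto simp: component_diff component_homogeneous[OF component_mem])

lemma mem_some_filtration: "\<exists>N. v \<in> filtration N"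
proof -
  obtain B where "\<And>n. component n v \<noteq> 0 \<Longrightarrow> n \<le> B"
    using bdd_above_finite[OF finite_components[of v]] by (auto simp: bdd_above_def)
  then have "v \<in> filtration B"
    unfolding filtration_iff_components by force
  then show ?thesis ..
qed

end

section \<open>Fixed vectors of a triangular operator\<close>

locale triangular_operator = graded_space scale V
  for scale :: "complex \<Rightarrow> 'v::ab_group_add \<Rightarrow> 'v" and V :: "int \<Rightarrow> 'v set" +
  fixes T :: "'v \<Rightarrow> 'v" and lam :: "int \<Rightarrow> complex"
  assumes bounded: "\<exists>n0. \<forall>n<n0. V n = {0}"
    and linear_T: "Vector_Spaces.linear scale scale T"
    and triangular: "v \<in> V n \<Longrightarrow> T v - scale (lam n) v \<in> filtration (n - 1)"
begin

sublocale T: Vector_Spaces.linear scale scale T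
  by (rule linear_T)

lemma T_mem_filtration:
  assumes "v \<in> filtration N"
  shows "T v \<in> filtration N"
  using assms unfolding filtration_def
proof (induction rule: span_induct_alt)
  case base
  then show ?case by (simp add: T.zero span_zero)
next
  case (step c x y)
  then obtain n where n: "n \<le> N" "x \<in> V n" by auto
  have "T x - scale (lam n) x \<in> filtration N"
    using triangular[OF n(2)] filtration_mono[of "n - 1" N] n(1) by auto
  moreover have "scale (lam n) x \<in> filtration N"
    using n by (intro subspace_scale[OF subspace_filtration] homogeneous_mem_filtration)
  ultimately have "T x \<in> filtration N"
    using subspace_add[OF subspace_filtration] by fastforce
  then show ?case
    using step by (simp add: T.add T.scale span_add span_scale filtration_def)
qed

lemma triangular_filtration:
  assumes v: "v \<in> filtration n"
  shows "T v - scale (lam n) v \<in> filtration (n - 1)"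
proof -
  define w where "w = v - component n v"
  have w: "w \<in> filtration (n - 1)"
    unfolding w_def by (rule minus_leading_component[OF v])
  have "T v - scale (lam n) v
    = (T (component n v) - scale (lam n) (component n v)) + (T w - scale (lam n) w)"
    by (simp add: w_def T.diff scale_right_diff_distrib)
  moreover have "T (component n v) - scale (lam n) (component n v) \<in> filtration (n - 1)"
    by (rule triangular[OF component_mem])
  moreover have "T w - scale (lam n) w \<in> filtration (n - 1)"
    using w by (intro subspace_diff[OF subspace_filtration] subspace_scale[OF subspace_filtration]
        T_mem_filtration)
  ultimately show ?thesis
    by (simp add: subspace_add[OF subspace_filtration])
qed

lemma filtration_eq_0:
  obtains b where "\<And>M. M < b \<Longrightarrow> filtration M = {0}"
proof -
  obtain b where b: "\<And>n. n < b \<Longrightarrow> V n = {0}"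
    using bounded by auto
  have "v = 0" if "M < b" "v \<in> filtration M" for M v
  proof -
    have "component n v = 0" for n
      using that b[of n] component_mem[of n v] by (cases "n \<le> M") (auto simp: filtration_iff_components)
    then show ?thesis
      using Sum_any_components[of v] by simp
  qed
  then have "filtration M = {0}" if "M < b" for M
    using that subspace_0[OF subspace_filtration] by blast
  then show ?thesis by (rule that)
qed

text \<open>Vanishing of \<open>F M\<close> for small \<open>M\<close> makes statements about all filtration steps accessible to
  induction from the bottom.\<close>

lemma filtration_induct:
  assumes bot: "\<And>M. filtration M = {0} \<Longrightarrow> P M"
    and step: "\<And>M. P (M - 1) \<Longrightarrow> P M"
  shows "P M"
proof -
  obtain b where b: "\<And>M. M < b \<Longrightarrow> filtration M = {0}"
    using filtration_eq_0 by blast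
  show ?thesis
  proof (cases "M < b")
    case True
    then show ?thesis by (intro bot b)
  next
    case False
    then have "b - 1 \<le> M" by simp
    then show ?thesis
    proof (induction M rule: int_ge_induct)
      case base
      then show ?case by (intro bot b) simp
    next
      case (step i)
      then show ?case using assms(2)[of "i + 1"] by simp
    qed
  qed
qed

text \<open>Comparing degree \<open>n\<close> parts in \<open>T v = v\<close> gives \<open>lam n v\<^sub>n = v\<^sub>n\<close> for the leading term.\<close>

lemma fixed_leading_component_eq_0:
  assumes v: "v \<in> filtration n" and fixed: "T v = v" and lam: "V n \<noteq> {0} \<longrightarrow> lam n \<noteq> 1"
  shows "v \<in> filtration (n - 1)"
proof -
  have "component n (T v - scale (lam n) v) = 0"
    using triangular_filtration[OF v] by (simp add: filtration_iff_components)
  then have "scale (1 - lam n) (component n v) = 0"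
    by (simp add: fixed component_diff component_scale scale_left_diff_distrib)
  then have "component n v = 0"
    using lam component_mem[of n v] by auto
  then show ?thesis
    using minus_leading_component[OF v] by simp
qed

lemma fixed_mem_lower_filtration:
  assumes "M \<le> N" and lam: "\<And>n. M < n \<Longrightarrow> n \<le> N \<Longrightarrow> V n \<noteq> {0} \<Longrightarrow> lam n \<noteq> 1"
    and v: "v \<in> filtration N" and fixed: "T v = v"
  shows "v \<in> filtration M"
  using assms(1) lam v
proof (induction N rule: int_ge_induct)
  case base
  then show ?case by simp
next
  case (step i)
  then have "v \<in> filtration (i + 1 - 1)"
    by (intro fixed_leading_component_eq_0[OF _ fixed]) auto
  then show ?case
    using step by simp
qed

lemma fixed_eq_0:
  assumes lam: "\<And>n. n \<le> N \<Longrightarrow> V n \<noteq> {0} \<Longrightarrow> lam n \<noteq> 1"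
    and v: "v \<in> filtration N" and fixed: "T v = v"
  shows "v = 0"
proof -
  obtain b where b: "\<And>M. M < b \<Longrightarrow> filtration M = {0}"
    using filtration_eq_0 by blast
  have "v \<in> filtration (min N (b - 1))"
    by (rule fixed_mem_lower_filtration[OF _ _ v fixed]) (use lam in auto)
  then show ?thesis
    using b[of "min N (b - 1)"] by simp
qed

text \<open>Since \<open>T - 1\<close> acts on the quotient \<open>F M / F (M - 1)\<close> as \<open>lam M - 1\<close>, dividing the leading term of \<open>w\<close>
  by this scalar solves the equation up to an error in \<open>F (M - 1)\<close>, which the induction
  hypothesis absorbs.\<close>

lemma T_minus_id_solvable:
  assumes "\<And>n. n \<le> M \<Longrightarrow> V n \<noteq> {0} \<Longrightarrow> lam n \<noteq> 1" and "w \<in> filtration M"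
  shows "\<exists>u\<in>filtration M. T u - u = w"
  using assms
proof (induction M arbitrary: w rule: filtration_induct)
  case (1 M)
  then show ?case by (auto simp: T.zero)
next
  case (2 M)
  \<comment> \<open>If \<open>V M = {0}\<close> then \<open>a = 0\<close>, also when \<open>lam M = 1\<close> and the quotient is a division by zero.\<close>
  define a where "a = scale (1 / (lam M - 1)) (component M w)"
  have a: "a \<in> V M"
    unfolding a_def by (rule subspace_scale[OF subspace_component component_mem])
  have lead: "scale (lam M) a - a = component M w"
  proof (cases "V M = {0}")
    case True
    then show ?thesis using a component_mem[of M w] by simp
  next
    case False
    then have "lam M - 1 \<noteq> 0" using 2(2)[of M] by simp
    then have "scale (lam M - 1) a = component M w" by (simp add: a_def)
    then show ?thesis by (simp add: scale_left_diff_distrib)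
  qed
  have "w - (T a - a) = (w - component M w) - (T a - scale (lam M) a)"
    by (simp flip: lead)
  then have "w - (T a - a) \<in> filtration (M - 1)"
    using subspace_diff[OF subspace_filtration minus_leading_component[OF 2(3)] triangular[OF a]]
    by argo
  then obtain u where u: "u \<in> filtration (M - 1)" "T u - u = w - (T a - a)"
    using 2(1)[of "w - (T a - a)"] 2(2) by auto
  show ?case
  proof
    show "T (a + u) - (a + u) = w"
      using u(2) by (simp add: T.add algebra_simps)
    show "a + u \<in> filtration M"
      using u(1) filtration_mono[of "M - 1" M] homogeneous_mem_filtration[OF a, of M]
      by (intro subspace_add[OF subspace_filtration]) auto
  qed
qed

definition fixed_vectors :: "int \<Rightarrow> 'v set" where
  "fixed_vectors N = {v \<in> filtration N. T v = v}"

lemma subspace_fixed_vectors: "subspace (fixed_vectors N)"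
  unfolding fixed_vectors_def
  by (rule subspaceI)
    (auto simp: T.zero T.add T.scale subspace_0[OF subspace_filtration]
      subspace_add[OF subspace_filtration] subspace_scale[OF subspace_filtration])

lemma fixed_vectors_eq_0:
  assumes "\<And>n. n \<le> N \<Longrightarrow> V n \<noteq> {0} \<Longrightarrow> lam n \<noteq> 1"
  shows "fixed_vectors N = {0}"
proof
  show "fixed_vectors N \<subseteq> {0}"
    using fixed_eq_0[OF assms] unfolding fixed_vectors_def by blast
  show "{0} \<subseteq> fixed_vectors N"
    using subspace_0[OF subspace_fixed_vectors] by blast
qed

text \<open>The case of a single degree in which \<open>T - 1\<close> degenerates on the graded piece: the leading
  term there is free, and everything below it is forced.\<close>

context
  fixes n0 N :: int
  assumes n0: "n0 \<le> N" "lam n0 = 1"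
    and lam: "\<And>n. n \<le> N \<Longrightarrow> V n \<noteq> {0} \<Longrightarrow> n \<noteq> n0 \<Longrightarrow> lam n \<noteq> 1"
begin

lemma lam_below: "n \<le> n0 - 1 \<Longrightarrow> V n \<noteq> {0} \<Longrightarrow> lam n \<noteq> 1"
  using lam[of n] n0 by simp

lemma fixed_vectors_subset: "fixed_vectors N \<subseteq> filtration n0"
proof
  fix v assume "v \<in> fixed_vectors N"
  then have "v \<in> filtration N" "T v = v"
    by (simp_all add: fixed_vectors_def)
  then show "v \<in> filtration n0"
    by (rule fixed_mem_lower_filtration[OF n0(1), rotated 1]) (use lam in auto)
qed

lemma fixed_vectors_below_eq_0:
  assumes "v \<in> fixed_vectors N" and "v \<in> filtration (n0 - 1)"
  shows "v = 0"
  by (rule fixed_eq_0[OF lam_below assms(2)]) (use assms(1) in \<open>simp_all add: fixed_vectors_def\<close>)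

lemma unique_fixed_extension:
  assumes v: "v \<in> V n0"
  shows "\<exists>!w. w \<in> filtration (n0 - 1) \<and> v + w \<in> fixed_vectors N"
proof (rule ex_ex1I)
  have "T v - v \<in> filtration (n0 - 1)"
    using triangular[OF v] n0 by simp
  then have "v - T v \<in> filtration (n0 - 1)"
    using subspace_neg[OF subspace_filtration, of "T v - v"] by simp
  then obtain w where w: "w \<in> filtration (n0 - 1)" "T w - w = v - T v"
    using T_minus_id_solvable[OF lam_below] by blast
  have "v + w \<in> filtration N"
    using w(1) filtration_mono[of "n0 - 1" N] homogeneous_mem_filtration[OF v n0(1)] n0(1)
    by (intro subspace_add[OF subspace_filtration]) auto
  moreover have "T (v + w) = v + w"
    using w(2) by (simp add: T.add algebra_simps)
  ultimately show "\<exists>w. w \<in> filtration (n0 - 1) \<and> v + w \<in> fixed_vectors N"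
    using w(1) by (auto simp: fixed_vectors_def)
next
  fix w w'
  assume w: "w \<in> filtration (n0 - 1) \<and> v + w \<in> fixed_vectors N"
    and w': "w' \<in> filtration (n0 - 1) \<and> v + w' \<in> fixed_vectors N"
  have "w - w' \<in> fixed_vectors N"
    using subspace_diff[OF subspace_fixed_vectors, of "v + w" N "v + w'"] w w' by simp
  moreover have "w - w' \<in> filtration (n0 - 1)"
    using w w' by (simp add: subspace_diff[OF subspace_filtration])
  ultimately show "w = w'"
    using fixed_vectors_below_eq_0[of "w - w'"] by simp
qed

lemma component_fixed_vectors_bij: "bij_betw (component n0) (fixed_vectors N) (V n0)"
  unfolding bij_betw_def
proof
  show "inj_on (component n0) (fixed_vectors N)"
  proof (rule inj_onI)
    fix u v
    assume uv: "u \<in> fixed_vectors N" "v \<in> fixed_vectors N" "component n0 u = component n0 v"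
    have d: "u - v \<in> fixed_vectors N"
      using uv by (simp add: subspace_diff[OF subspace_fixed_vectors])
    have "u - v \<in> filtration (n0 - 1)"
      using minus_leading_component[of "u - v" n0] d fixed_vectors_subset uv(3)
      by (auto simp: component_diff)
    with d show "u = v"
      using fixed_vectors_below_eq_0[of "u - v"] by simp
  qed
  show "component n0 ` fixed_vectors N = V n0"
  proof
    show "component n0 ` fixed_vectors N \<subseteq> V n0"
      using component_mem by blast
    show "V n0 \<subseteq> component n0 ` fixed_vectors N"
    proof
      fix v assume v: "v \<in> V n0"
      then obtain w where w: "w \<in> filtration (n0 - 1)" "v + w \<in> fixed_vectors N"
        using unique_fixed_extension by blast
      have "component n0 (v + w) = v"
        using w(1) by (simp add: component_add component_homogeneous[OF v] filtration_iff_components)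
      with w(2) show "v \<in> component n0 ` fixed_vectors N"
        by force
    qed
  qed
qed

lemma dim_fixed_vectors: "dim (fixed_vectors N) = dim (V n0)"
  using dim_linear_inj_image[OF linear_component subspace_fixed_vectors]
    component_fixed_vectors_bij by (metis bij_betw_def)

end

end

section \<open>The operator \<open>K\<close> is triangular\<close>

context graded_space
begin

text \<open>Local nilpotency: powers of \<open>A\<close> push each of the finitely many components of \<open>v\<close> below the
  lowest degree. It keeps the support of the exponential series finite; \<^const>\<open>Sum_any\<close> would
  be \<open>0\<close> on an infinite support.\<close>

lemma lowering_funpow_eq_0:
  assumes bounded: "\<exists>n0. \<forall>n<n0. V n = {0}"
    and A: "Vector_Spaces.linear scale scale A"
    and lower: "\<And>n v. v \<in> V n \<Longrightarrow> A v \<in> V (n - 1)"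
  shows "\<exists>m. \<forall>i\<ge>m. (A ^^ i) v = 0"
proof -
  interpret A: Vector_Spaces.linear scale scale A by (rule A)
  obtain b where b: "\<And>n. n < b \<Longrightarrow> V n = {0}"
    using bounded by auto
  have hom: "(A ^^ i) x \<in> V (n - int i)" if "x \<in> V n" for i n x
    using that
  proof (induction i)
    case (Suc i)
    then show ?case using lower[of "(A ^^ i) x" "n - int i"] by (simp add: algebra_simps)
  qed simp
  have zero: "(A ^^ i) 0 = 0" for i
    by (induction i) (simp_all add: A.zero)
  have add: "(A ^^ i) (scale c x + y) = scale c ((A ^^ i) x) + (A ^^ i) y" for i c x y
    by (induction i) (simp_all add: A.add A.scale)
  obtain N where "v \<in> filtration N"
    using mem_some_filtration by blast
  then have "\<forall>i\<ge>nat (N - b + 1). (A ^^ i) v = 0"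
    unfolding filtration_def
  proof (induction rule: span_induct_alt)
    case base
    then show ?case by (simp add: zero)
  next
    case (step c x y)
    then obtain n where n: "n \<le> N" "x \<in> V n" by auto
    have "(A ^^ i) x = 0" if "i \<ge> nat (N - b + 1)" for i
      using hom[OF n(2), of i] b[of "n - int i"] n(1) that by simp
    then show ?case using step by (simp add: add)
  qed
  then show ?thesis by blast
qed

end

context quasi_voa
begin

lemma L1_lowers_degree:
  assumes v: "v \<in> V n"
  shows "L 1 v \<in> V (n - 1)"
proof -
  interpret L0: Vector_Spaces.linear scale scale "L 0" by (rule linear_L) simp
  interpret L1: Vector_Spaces.linear scale scale "L 1" by (rule linear_L) simp
  define w where "w = L 1 v"
  \<comment> \<open>The relation \<open>[L(0), L(1)] = -L(1)\<close> makes \<open>w\<close> an eigenvector of \<open>L(0)\<close>, and the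
    eigenspaces of \<open>L(0)\<close> are no larger than the homogeneous components.\<close>
  have "L 0 w = scale (of_int (n - 1)) w"
    using sl2_relations[of 0 1 v] L0_eigen[OF v]
    by (simp add: w_def L1.scale scale_left_diff_distrib algebra_simps)
  moreover have "component m (L 0 w) = scale (of_int m) (component m w)" for m
  proof -
    have fin: "finite {m. scale (of_int m) (component m w) \<noteq> 0}"
      by (rule finite_subset[OF _ finite_components[of w]]) auto
    have "L 0 w = L 0 (Sum_any (\<lambda>m. component m w))"
      by (simp add: Sum_any_components)
    also have "\<dots> = Sum_any (\<lambda>m. scale (of_int m) (component m w))"
      by (subst linear_Sum_any[OF linear_L finite_components])
        (simp_all add: L0_eigen[OF component_mem])
    finally show ?thesis
      using component_Sum_any[of "\<lambda>m. scale (of_int m) (component m w)" m] fin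
      by (simp add: component_mem subspace_scale[OF subspace_component])
  qed
  ultimately have "scale (of_int (m - (n - 1))) (component m w) = 0" for m
    by (metis component_scale right_minus_eq scale_left_diff_distrib of_int_diff)
  then have "component m w = 0" if "m \<noteq> n - 1" for m
    using that by (metis scale_eq_0_iff of_int_eq_0_iff right_minus_eq)
  then have "Sum_any (\<lambda>m. component m w) = (\<Sum>m\<in>{n - 1}. component m w)"
    by (intro Sum_any.expand_superset) auto
  then have "w = component (n - 1) w"
    by (simp add: Sum_any_components)
  then show ?thesis
    unfolding w_def by (metis component_mem)
qed

lemma power_L0_homogeneous:
  assumes "v \<in> V n"
  shows "power_L0 x v = scale (x powi (- 2 * n)) v"
proof -
  have "power_L0 x v = (\<Sum>m\<in>{n}. scale (x powi (- 2 * m)) (component m v))"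
    unfolding power_L0_def
    by (rule Sum_any.expand_superset) (auto simp: component_homogeneous[OF assms] split: if_splits)
  then show ?thesis
    by (simp add: component_homogeneous[OF assms])
qed

lemma linear_power_L0: "Vector_Spaces.linear scale scale (power_L0 x)"
proof (unfold_locales)
  have fin: "finite {n. scale (x powi (- 2 * n)) (component n v) \<noteq> 0}" for v
    by (rule finite_subset[OF _ finite_components[of v]]) auto
  show "power_L0 x (u + v) = power_L0 x u + power_L0 x v" for u v
    unfolding power_L0_def component_add scale_right_distrib
    by (rule Sum_any.distrib[OF fin fin])
  show "power_L0 x (scale c v) = scale c (power_L0 x v)" for c v
    unfolding power_L0_def linear_Sum_any[OF linear_scale_self fin] component_scale
    by (simp add: mult.commute)
qed

context
  fixes A :: "'v \<Rightarrow> 'v"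
  assumes linear_A: "Vector_Spaces.linear scale scale A"
    and lowering_A: "\<And>n v. v \<in> V n \<Longrightarrow> A v \<in> V (n - 1)"
begin

interpretation A: Vector_Spaces.linear scale scale A
  by (rule linear_A)

lemma finite_exp_support: "finite {i. scale (1 / fact i) ((A ^^ i) v) \<noteq> 0}"
proof -
  have "\<exists>m. \<forall>i\<ge>m. (A ^^ i) v = 0"
    by (rule lowering_funpow_eq_0[OF bounded_below linear_A]) (rule lowering_A)
  then obtain m where m: "\<forall>i\<ge>m. (A ^^ i) v = 0" ..
  have "{i. scale (1 / fact i) ((A ^^ i) v) \<noteq> 0} \<subseteq> {..<m}"
  proof
    fix i assume "i \<in> {i. scale (1 / fact i) ((A ^^ i) v) \<noteq> 0}"
    then have "(A ^^ i) v \<noteq> 0" by simp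
    then show "i \<in> {..<m}" using m by (meson lessThan_iff not_le)
  qed
  then show ?thesis
    by (rule finite_subset) simp
qed

lemma linear_exp_op: "Vector_Spaces.linear scale scale (exp_op A)"
proof (unfold_locales)
  have add: "(A ^^ i) (u + v) = (A ^^ i) u + (A ^^ i) v" for i u v
    by (induction i) (simp_all add: A.add)
  have sc: "(A ^^ i) (scale c v) = scale c ((A ^^ i) v)" for i c v
    by (induction i) (simp_all add: A.scale)
  show "exp_op A (u + v) = exp_op A u + exp_op A v" for u v
    unfolding exp_op_def add scale_right_distrib
    by (rule Sum_any.distrib[OF finite_exp_support finite_exp_support])
  show "exp_op A (scale c v) = scale c (exp_op A v)" for c v
    unfolding exp_op_def linear_Sum_any[OF linear_scale_self finite_exp_support] sc
    by (simp add: mult.commute)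
qed

text \<open>The term of index \<open>0\<close> of the exponential series is \<open>v\<close>; every later one has degree at
  most \<open>n - 1\<close>.\<close>

lemma exp_op_unipotent:
  assumes v: "v \<in> V n"
  shows "exp_op A v - v \<in> filtration (n - 1)"
proof -
  have hom: "(A ^^ i) v \<in> V (n - int i)" for i
  proof (induction i)
    case (Suc i)
    then show ?case using lowering_A[of "(A ^^ i) v" "n - int i"] by (simp add: algebra_simps)
  qed (simp add: v)
  define S where "S = {i. scale (1 / fact i) ((A ^^ i) v) \<noteq> 0}"
  have S: "finite S"
    unfolding S_def by (rule finite_exp_support)
  have "exp_op A v = (\<Sum>i\<in>insert 0 S. scale (1 / fact i) ((A ^^ i) v))"
    unfolding exp_op_def using S by (intro Sum_any.expand_superset) (auto simp: S_def)
  also have "\<dots> = v + (\<Sum>i\<in>S - {0}. scale (1 / fact i) ((A ^^ i) v))"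
    using S by (simp add: sum.insert_remove)
  finally have "exp_op A v - v = (\<Sum>i\<in>S - {0}. scale (1 / fact i) ((A ^^ i) v))"
    by simp
  also have "\<dots> \<in> filtration (n - 1)"
    by (intro subspace_sum[OF subspace_filtration] subspace_scale[OF subspace_filtration]
        homogeneous_mem_filtration[OF hom]) auto
  finally show ?thesis .
qed

end

lemma triangular_weighted_K:
  assumes j: "aut_factor g \<tau> \<noteq> 0"
  shows "triangular_operator scale V (weighted_K k g \<tau>) (\<lambda>n. aut_factor g \<tau> powi (k - 2 * n))"
proof -
  define j where "j = aut_factor g \<tau>"
  define A where "A = (\<lambda>w. scale (- of_real (g$2$1) * j) (L 1 w))"
  interpret L1: Vector_Spaces.linear scale scale "L 1" by (rule linear_L) simp
  have A: "Vector_Spaces.linear scale scale A"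
    by unfold_locales (simp_all add: A_def L1.add L1.scale scale_right_distrib mult.commute)
  have low: "A v \<in> V (n - 1)" if "v \<in> V n" for n v
    unfolding A_def using L1_lowers_degree[OF that] by (rule subspace_scale[OF subspace_component])
  have T: "weighted_K k g \<tau> v = scale (j powi k) (exp_op A (power_L0 j v))" for v
    by (simp add: weighted_K_def K_def j_def A_def)
  interpret E: Vector_Spaces.linear scale scale "exp_op A" by (rule linear_exp_op[OF A low])
  interpret P: Vector_Spaces.linear scale scale "power_L0 j" by (rule linear_power_L0)
  have "weighted_K k g \<tau> v - scale (j powi (k - 2 * n)) v \<in> filtration (n - 1)"
    if v: "v \<in> V n" for v n
  proof -
    have "j powi (k - 2 * n) = j powi k * j powi (- 2 * n)"
      using j by (simp add: j_def flip: power_int_add)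
    then have "weighted_K k g \<tau> v - scale (j powi (k - 2 * n)) v
      = scale (j powi (k - 2 * n)) (exp_op A v - v)"
      by (simp add: T power_L0_homogeneous[OF v] E.scale scale_right_diff_distrib)
    then show ?thesis
      using exp_op_unipotent[OF A low v] by (simp add: subspace_scale[OF subspace_filtration])
  qed
  moreover have "Vector_Spaces.linear scale scale (weighted_K k g \<tau>)"
    by unfold_locales (simp_all add: T P.add P.scale E.add E.scale scale_right_distrib mult.commute)
  ultimately show ?thesis
    using bounded_below by unfold_locales (simp_all add: j_def module_hom_iff linear_iff_module_hom)
qed

end

section \<open>The automorphy factor\<close>

lemma det_eq_1_of_mem_PSL2R:
  assumes "\<gamma> \<in> carrier PSL2R" and "g \<in> \<gamma>"
  shows "det g = 1"
proof -
  interpret normal "{mat 1, - mat 1}" SL2R by (rule normal_PSL2R)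
  have "g \<in> carrier SL2R"
    using assms rcosets_carrier unfolding PSL2R_def FactGroup_def by auto
  then show ?thesis by (simp add: SL2R_def)
qed

text \<open>A nonreal \<open>\<tau>\<close> is a root of \<open>c z + d\<close> only if the lower row of \<open>g\<close> vanishes.\<close>

lemma aut_factor_nonzero:
  assumes "det g = 1" and "\<tau> \<in> upper_half_plane"
  shows "aut_factor g \<tau> \<noteq> 0"
proof
  assume *: "aut_factor g \<tau> = 0"
  then have "g$2$1 * Im \<tau> = 0"
    by (simp add: aut_factor_def complex_eq_iff)
  then have "g$2$1 = 0"
    using assms(2) by (simp add: upper_half_plane_def)
  moreover from this * have "g$2$2 = 0"
    by (simp add: aut_factor_def)
  ultimately show False
    using assms(1) by (simp add: det_2)
qed

section \<open>Fixed vectors at an elliptic point\<close>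

theorem proposition3p6:
  fixes scale :: "complex \<Rightarrow> 'v::ab_group_add \<Rightarrow> 'v"
    and V :: "int \<Rightarrow> 'v set"
    and Y :: "'v \<Rightarrow> int \<Rightarrow> 'v \<Rightarrow> 'v"
    and vac :: 'v
    and L :: "int \<Rightarrow> 'v \<Rightarrow> 'v"
    and \<Gamma> :: "(real^2^2) set set"
    and \<gamma> :: "(real^2^2) set"
    and g :: "real^2^2"
    and \<tau> :: complex
    and m :: nat
    and k N :: int
  assumes "quasi_voa scale V Y vac L"
    and "fuchsian_first_kind \<Gamma>"
    and "elliptic_point \<Gamma> \<tau>"
    and "card (stabilizer \<Gamma> \<tau>) = m"
    and "\<gamma> \<in> \<Gamma>"
    and "generate PSL2R {\<gamma>} = stabilizer \<Gamma> \<tau>"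
    and "g \<in> \<gamma>"
  shows
    "let lam = (\<lambda>n. aut_factor g \<tau> powi (k - 2 * n));
         F = graded_space.filtration scale V;
         proj = graded_space.component V;
         T = quasi_voa.weighted_K scale V L k g \<tau>;
         Fix = quasi_voa.fixed_subspace scale V L k N g \<tau>
     in
       (\<forall>n\<le>N. \<forall>v\<in>F n. T v - scale (lam n) v \<in> F (n - 1)) \<and>
       (\<forall>n0\<le>N. V n0 \<noteq> {0} \<and> lam n0 = 1 \<and>
           (\<forall>n\<le>N. V n \<noteq> {0} \<and> n \<noteq> n0 \<longrightarrow> lam n \<noteq> 1) \<longrightarrow>
         module.subspace scale Fix \<and>
         vector_space.dim scale Fix = vector_space.dim scale (V n0) \<and>
         Vector_Spaces.linear scale scale (proj n0) \<and>
         bij_betw (proj n0) Fix (V n0) \<and>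
         (\<forall>v0\<in>V n0. \<exists>!v0'. v0' \<in> F (n0 - 1) \<and> v0 + v0' \<in> Fix)) \<and>
       ((\<forall>n\<le>N. V n \<noteq> {0} \<longrightarrow> lam n \<noteq> 1) \<longrightarrow> Fix = {0})"
proof -
  interpret quasi_voa scale V Y vac L by (rule assms(1))
  have "\<gamma> \<in> carrier PSL2R"
    using assms(2,5) subgroup.subset unfolding fuchsian_first_kind_def by blast
  then have "det g = 1"
    using assms(7) by (rule det_eq_1_of_mem_PSL2R)
  moreover have "\<tau> \<in> upper_half_plane"
    using assms(3) by (simp add: elliptic_point_def)
  ultimately have j: "aut_factor g \<tau> \<noteq> 0"
    by (rule aut_factor_nonzero)
  define lam where "lam = (\<lambda>n. aut_factor g \<tau> powi (k - 2 * n))"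
  interpret triangular_operator scale V "weighted_K k g \<tau>" lam
    unfolding lam_def by (rule triangular_weighted_K[OF j])
  have Fix: "fixed_subspace k N g \<tau> = fixed_vectors N"
    by (simp add: fixed_subspace_def fixed_vectors_def)
  show ?thesis
    unfolding Let_def Fix lam_def[symmetric]
  proof (intro conjI allI impI ballI; (elim conjE)?)
    fix n v
    assume "v \<in> filtration n"
    then show "weighted_K k g \<tau> v - scale (lam n) v \<in> filtration (n - 1)"
      by (rule triangular_filtration)
  next
    fix n0
    assume n0: "n0 \<le> N" "lam n0 = 1" "\<forall>n\<le>N. V n \<noteq> {0} \<and> n \<noteq> n0 \<longrightarrow> lam n \<noteq> 1"
    then have lam: "lam n \<noteq> 1" if "n \<le> N" "V n \<noteq> {0}" "n \<noteq> n0" for n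
      using that by blast
    show "subspace (fixed_vectors N)"
      by (rule subspace_fixed_vectors)
    show "dim (fixed_vectors N) = dim (V n0)"
      using n0(1,2) lam by (rule dim_fixed_vectors)
    show "Vector_Spaces.linear scale scale (component n0)"
      by (rule linear_component)
    show "bij_betw (component n0) (fixed_vectors N) (V n0)"
      using n0(1,2) lam by (rule component_fixed_vectors_bij)
    show "\<exists>!v0'. v0' \<in> filtration (n0 - 1) \<and> v0 + v0' \<in> fixed_vectors N" if "v0 \<in> V n0" for v0
      using n0(1,2) lam that by (rule unique_fixed_extension)
  next
    assume "\<forall>n\<le>N. V n \<noteq> {0} \<longrightarrow> lam n \<noteq> 1"
    then show "fixed_vectors N = {0}"
      by (intro fixed_vectors_eq_0) blast
  qed
qed

end
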